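(* Let $U\subseteq\mathbb{R}^3$ be an open set, let $H,C,\nu\in C^\infty(U,\mathbb{R})$ be smooth real functions, and let $X(u)=\nu(u)\,(\nabla H(u)\times\nabla C(u))$ for $u\in U$. Then, for $u\in U$, the vectors $\nabla H(u),\nabla C(u),X(u)$ are linearly independent if and only if $u$ is not an equilibrium point of the dynamical system $\dot u=\nu(u)\,(\nabla H(u)\times\nabla C(u))$.
   Context: $\nabla$ is the Euclidean gradient and $\times$ the cross product in $\mathbb{R}^3$. An equilibrium point is a point $u\in U$ with $X(u)=0$. In the paper's setting it is also supposed, to eliminate trivial cases, that $H$ and $C$ are functionally independent (linearly independent gradients) at least on some open subset $V\subseteq U$. *)

theory Defs
  imports "HOL-Analysis.Analysis"
begin

text \<open>
  Functions on an open set \<open>U\<close> are represented by total functions. Only their values on \<open>U\<close>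
  matter: all derivatives below are taken at points of the open set \<open>U\<close>.
\<close>

text \<open>
  For open \<open>U\<close> and a finite-dimensional domain, \<open>Ck_on k f U\<close> says that \<open>f\<close> is of class
  \<open>C\<^sup>k\<close> on \<open>U\<close>: requiring that \<open>f\<close> is differentiable with all directional derivatives
  of class \<open>C\<^sup>k\<close> amounts to requiring this of the partial derivatives.
\<close>

primrec Ck_on :: "nat \<Rightarrow> ('a::euclidean_space \<Rightarrow> real) \<Rightarrow> 'a set \<Rightarrow> bool" where
  "Ck_on 0 f U \<longleftrightarrow> continuous_on U f"
| "Ck_on (Suc k) f U \<longleftrightarrow>
     (\<forall>x\<in>U. f differentiable (at x)) \<and> (\<forall>v. Ck_on k (\<lambda>x. frechet_derivative f (at x) v) U)"

definition smooth_on :: "('a::euclidean_space \<Rightarrow> real) \<Rightarrow> 'a set \<Rightarrow> bool" where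
  "smooth_on f U \<longleftrightarrow> (\<forall>k. Ck_on k f U)"

definition gradient :: "('a::euclidean_space \<Rightarrow> real) \<Rightarrow> 'a \<Rightarrow> 'a" where
  "gradient f u = (THE D. GDERIV f u :> D)"

lemma gradient_eqI:
  assumes "GDERIV f u :> D"
  shows "gradient f u = D"
  unfolding gradient_def
proof (rule the_equality[where P = "\<lambda>D. GDERIV f u :> D", OF assms])
  fix E assume E: "GDERIV f u :> E"
  have "(\<lambda>h. h \<bullet> E) = (\<lambda>h. h \<bullet> D)"
    by (rule has_derivative_unique[OF E[unfolded gderiv_def] assms[unfolded gderiv_def]])
  then have "\<forall>h. h \<bullet> E = h \<bullet> D"
    by (simp add: fun_eq_iff)
  then show "E = D"
    by (simp only: vector_eq_ldot)
qed

lemma gradient_works: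
  assumes "f differentiable (at u)"
  shows "GDERIV f u :> gradient f u"
proof -
  from assms obtain f' where f': "(f has_derivative f') (at u)"
    unfolding differentiable_def by blast
  then have lin: "linear f'"
    by (rule has_derivative_linear)
  have "f' = (\<lambda>h. h \<bullet> (\<Sum>b\<in>Basis. f' b *\<^sub>R b))"
  proof
    fix h
    have "f' h = f' (\<Sum>b\<in>Basis. (h \<bullet> b) *\<^sub>R b)"
      by (simp only: euclidean_representation)
    also have "\<dots> = h \<bullet> (\<Sum>b\<in>Basis. f' b *\<^sub>R b)"
      by (simp add: linear_sum[OF lin] linear_cmul[OF lin] inner_sum_right mult.commute)
    finally show "f' h = h \<bullet> (\<Sum>b\<in>Basis. f' b *\<^sub>R b)" .
  qed
  with f' have "GDERIV f u :> (\<Sum>b\<in>Basis. f' b *\<^sub>R b)"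
    unfolding gderiv_def by metis
  moreover from this have "gradient f u = (\<Sum>b\<in>Basis. f' b *\<^sub>R b)"
    by (rule gradient_eqI)
  ultimately show ?thesis
    by simp
qed

text \<open>
  Linear independence of a finite family of vectors. The library predicate \<^const>\<open>independent\<close> is
  about sets and so forgets repetitions (for \<open>a \<noteq> 0\<close> the set \<open>{a, a}\<close> is independent,
  but the family \<open>a, a\<close> is not), hence the distinctness condition.
\<close>

definition lin_indep_family :: "'a::real_vector list \<Rightarrow> bool" where
  "lin_indep_family vs \<longleftrightarrow> distinct vs \<and> independent (set vs)"

definition equilibrium_point :: "'a::real_normed_vector set \<Rightarrow> ('a \<Rightarrow> 'a) \<Rightarrow> 'a \<Rightarrow> bool" where
  \<comment> \<open>of the autonomous system \<open>du/dt = X u\<close> on \<open>U\<close>\<close>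
  "equilibrium_point U X u \<longleftrightarrow> u \<in> U \<and> X u = 0"

end

theory Submission
  imports Defs
begin

text \<open>The claim is linear algebra at a single point, carried by
  \<open>lin_indep_family_cross3\<close> with the two gradients as \<open>a\<close>,
  \<open>b\<close> and \<nu>(u) as \<open>c\<close>. An independent family contains no zero vector.
  Conversely, if a multiple of the cross product is nonzero, then its factors are not parallel, and
  being normal to their plane it lies outside their span.\<close>

lemma lin_indep_family_cross3:
  fixes a b :: "real ^ 3"
  shows "lin_indep_family [a, b, c *\<^sub>R cross3 a b] \<longleftrightarrow> c *\<^sub>R cross3 a b \<noteq> 0"
proof
  assume "lin_indep_family [a, b, c *\<^sub>R cross3 a b]"
  then show "c *\<^sub>R cross3 a b \<noteq> 0"
    unfolding lin_indep_family_def by (metis dependent_zero list.set_intros)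
next
  define x where "x = c *\<^sub>R cross3 a b"
  assume "c *\<^sub>R cross3 a b \<noteq> 0"
  then have x: "x \<noteq> 0" and ab: "cross3 a b \<noteq> 0"
    by (auto simp: x_def)
  \<comment> \<open>If \<open>a\<close> were a multiple of \<open>b\<close>, the cross product would
    be a multiple of \<open>cross3 b b\<close>, which is zero.\<close>
  have a: "a \<notin> span {b}"
    using ab by (auto simp: span_singleton cross_mult_left)
  have b: "b \<noteq> 0"
    using ab by auto
  have "x \<notin> span {a, b}"
  proof
    assume "x \<in> span {a, b}"
    \<comment> \<open>Orthogonality to the generators passes to their span, so \<open>x\<close>
      would be orthogonal to itself.\<close>
    moreover have "orthogonal x y" if "y \<in> {a, b}" for y
      using that by (auto simp: x_def orthogonal_def dot_cross_self)
    ultimately have "orthogonal x x"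
      by (rule orthogonal_to_span)
    with x show False
      by (simp add: orthogonal_self)
  qed
  \<comment> \<open>Generators lie in their span; this yields the distinctness that a family, unlike
    a set, requires.\<close>
  moreover from this have "x \<noteq> a" "x \<noteq> b"
    by (auto simp: span_base)
  moreover have "a \<noteq> b"
    using a by (auto simp: span_base)
  moreover have "independent {a, b}"
    using a b \<open>a \<noteq> b\<close> by (simp add: independent_insert)
  ultimately have "distinct [a, b, x]" "independent (insert x {a, b})"
    by (auto simp: independent_insert)
  then show "lin_indep_family [a, b, c *\<^sub>R cross3 a b]"
    by (simp add: lin_indep_family_def x_def insert_commute)
qed

theorem proposition3p5:
  fixes U :: "(real ^ 3) set"
    and H C \<nu> :: "real ^ 3 \<Rightarrow> real"
    and X :: "real ^ 3 \<Rightarrow> real ^ 3"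
    and u :: "real ^ 3"
  assumes "open U"
    and "smooth_on H U" and "smooth_on C U" and "smooth_on \<nu> U"
    and "\<And>v. v \<in> U \<Longrightarrow> X v = \<nu> v *\<^sub>R cross3 (gradient H v) (gradient C v)"
    and "u \<in> U"
  shows "lin_indep_family [gradient H u, gradient C u, X u] \<longleftrightarrow> \<not> equilibrium_point U X u"
  \<comment> \<open>As \<open>u\<close> lies in \<open>U\<close>, the formula for \<open>X\<close>
    applies there and being an equilibrium reduces to \<open>X u = 0\<close>.\<close>
  using assms(5)[OF assms(6)] assms(6) lin_indep_family_cross3
  by (simp add: equilibrium_point_def)

end
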